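(* Let $m\ge 2$ and let $\chi^m_n=\sum_{d\ge0}(-1)^dC^d_n$ be the reduced Euler characteristic of the cell complex $X^m_n$ produced by the Comb Algorithm applied to $\mathrm{Ind}(\Delta^m_n)$. Given the initial conditions for $0\le n\le 3$ that $C^d_n=0$ for all $d\ge 0$ except that, if $m=2$, $C^0_0=1$, $C^1_1=2$, $C^2_2=1$, $C^2_3=2$, and, if $m\ge 3$, $C^0_0=C^1_1=C^{m-1}_1=C^m_2=C^2_3=C^m_3=1$, one has for every $n\ge 4$ $$\chi^m_n=(1+(-1)^m)\,\chi^m_{n-3}+(-1)^{m+1}\chi^m_{n-4}.$$
   Context: All graphs are finite and simple; $N(p)$ is the set of neighbors of $p$. $\mathrm{Ind}(G)$ is the independence complex of $G$: the simplicial complex on $V(G)$ whose faces are the independent sets of $G$ (including $\emptyset$); a face with $r$ vertices has dimension $r-1$. $Pa_\ell$ is the path on $\ell$ vertices; $\biguplus$ is disjoint union. Graphs. For $m\ge1,n\ge 1$, $Y^m_n$ is the extended star: a central vertex of degree $m$ with $m$ paths ("tendrils") of $n$ edges each emanating from it; $Y^m_0$ is a single vertex. $\widehat Y^m_n$ consists of two vertices $a,b$ joined by $m$ internally disjoint paths with $n+1$ edges each; the $k$-th vertex away from $a$ on the $j$-th path is $(j,k)$. For $n\ge 1$, $\Delta^m_n$ is $\widehat Y^m_{n+1}$ with $n$ additional vertices $1,\dots,n$ and additional edges $\{k,(j,k)\}$, $\{k,(j,k+1)\}$ for $j\in\{1,\dots,m\}$, $k\in\{1,\dots,n\}$. Also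 $\Delta^m_0:=\widehat Y^m_1$ and $\Delta^m_{-1}$ is a single vertex. Matching trees. For disjoint $A,B\subseteq V(G)$ let $\Sigma(A,B)=\{I\in\mathrm{Ind}(G): A\subseteq I,\ B\cap I=\emptyset\}$. A matching tree starts with the root $\Sigma(\emptyset,\emptyset)$; as long as some leaf $\Sigma(A,B)$ has at least two elements, perform one of: (1) if some $p\in V\setminus(A\cup B)$ has $N(p)\setminus(A\cup B)=\emptyset$, give the leaf one child labeled $\emptyset$ ($p$ is a free vertex); (2) if some $p\in V\setminus(A\cup B)$ has $N(p)\setminus(A\cup B)=\{v\}$, give the leaf one child $\Sigma(A\cup\{v\},B\cup N(v))$; (3) choose $v\in V\setminus(A\cup B)$ and give the leaf two children $\Sigma(A,B\cup\{v\})$ and $\Sigma(A\cup\{v\},B\cup N(v))$. The available graph at a node is the subgraph induced on $V\setminus(A\cup B)$. The critical cells are the faces $A$ for the nonempty final leaves $\Sigma(A,B)$. By discrete Morse theory, $\mathrm{Ind}(G)$ is homotopy equivalent to a cell complex with one $d$-cell for each $d$-dimensional critical cell, plus one extra $0$-cell (the base $0$-cell, present since $\emptyset$ is matched). Trees for auxiliary graphs. Path: repeatedly apply (2) with $p$ an end vertex and $v$ its neighbor, and (1) if an isolated vertex remains. $Y^m_n$ with $n\equiv 0 \bmod 3$: on each tendril in turn apply (2) starting from its leaf ($p$ the leaf, $v$ its neighbor, and so on) until the tendril is exhausted, then apply (1) to the central vertex. $Y^m_n$ with $n\not\equiv0\bmod 3$: apply (3) with $v$ the central vertex, then the path trees to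 the remaining disjoint paths. $\widehat Y^m_n$: apply (3) with $v=b$; the available graphs are then $Y^m_{n-1}$ and $Y^m_n$ (centered at $a$), to which the previous trees are applied. Comb Algorithm for $\mathrm{Ind}(\Delta^m_n)$ ($m\ge2$, $n\ge1$): for $k=1,\dots,n$ successively apply (3) with $v=k$ at $\Sigma(\emptyset,\{1,\dots,k-1\})$. Then: at $\Sigma(\{1\},N(1))$ apply (1) with $p=a$; at $\Sigma(\{k\},N(k)\cup\{1,\dots,k-1\})$ for $2\le k\le n-1$, the available graph is $Y^m_{k-1}\biguplus\Delta^m_{n-(k+1)}$, and one applies the tree of $Y^m_{k-1}$ and then, below any nonempty leaf, recursively the Comb Algorithm for $\Delta^m_{n-(k+1)}$ (the tree of $\widehat Y^m_1$ if $n-(k+1)=0$); at $\Sigma(\{n\},N(n)\cup\{1,\dots,n-1\})$ apply (1) with $p=b$; at $\Sigma(\emptyset,\{1,\dots,n\})$ the available graph is $\widehat Y^m_{n+1}$ and one applies its tree. $X^m_n$ ($n\ge1$) is the resulting cell complex, homotopy equivalent to $\mathrm{Ind}(\Delta^m_n)$; $X^m_0:=S^0$ (two $0$-cells). $C^d_n$ is the number of $d$-cells of $X^m_n$ for $d\ge1$, and $C^0_n$ is one less than the number of $0$-cells (so for $n\ge 1$, $C^d_n$ is the number of critical cells of dimension $d$); $C^d_n=0$ if $d<0$ or $n<0$. Because of the convention for $C^0_n$, the reduced Euler characteristic of $X^m_n$ is $\sum_{d\ge0}(-1)^dC^d_n$. *)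

theory Defs
  imports "HOL-Library.Groups_Big_Fun"
begin

section \<open>Graphs and independence complexes\<close>

type_synonym 'v graph = "'v set \<times> 'v set set"

definition nbrs :: "'v graph \<Rightarrow> 'v \<Rightarrow> 'v set" where
  "nbrs G p = {q. {p, q} \<in> snd G}"

definition Ind :: "'v graph \<Rightarrow> 'v set set" where
  "Ind G = {I. I \<subseteq> fst G \<and> (\<forall>x\<in>I. \<forall>y\<in>I. {x, y} \<notin> snd G)}"

definition face_dim :: "'v set \<Rightarrow> int" where
  "face_dim I = int (card I) - 1"


section \<open>The graphs \<open>Y-hat\<close> and \<open>Delta\<close>\<close>

text \<open>\<open>VA\<close> and \<open>VB\<close> are the vertices $a$ and $b$, \<open>Pt j k\<close> is $(j,k)$, and \<open>Mid k\<close> is the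
  additional vertex $k$ of $\Delta^m_n$.\<close>

datatype vertex = VA | VB | Mid nat | Pt nat nat

text \<open>The \<open>k\<close>-th vertex, \<open>k = 0, \<dots>, n + 1\<close>, on the \<open>j\<close>-th path from $a$ to $b$.\<close>

definition path_vertex :: "nat \<Rightarrow> nat \<Rightarrow> nat \<Rightarrow> vertex" where
  "path_vertex n j k = (if k = 0 then VA else if k = n + 1 then VB else Pt j k)"

definition hat_Y :: "nat \<Rightarrow> nat \<Rightarrow> vertex graph" where
  "hat_Y m n =
    ({VA, VB} \<union> {Pt j k | j k. j \<in> {1..m} \<and> k \<in> {1..n}},
     {{path_vertex n j k, path_vertex n j (k + 1)} | j k. j \<in> {1..m} \<and> k \<in> {0..n}})"

text \<open>For \<open>n = 0\<close> there are no additional vertices, so that \<open>Delta m 0 = hat_Y m 1\<close>.\<close>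

definition Delta :: "nat \<Rightarrow> nat \<Rightarrow> vertex graph" where
  "Delta m n =
    (fst (hat_Y m (n + 1)) \<union> {Mid k | k. k \<in> {1..n}},
     snd (hat_Y m (n + 1))
       \<union> {{Mid k, Pt j k} | j k. j \<in> {1..m} \<and> k \<in> {1..n}}
       \<union> {{Mid k, Pt j (k + 1)} | j k. j \<in> {1..m} \<and> k \<in> {1..n}})"


section \<open>Matching trees\<close>

definition Sigma_node :: "'v graph \<Rightarrow> 'v set \<Rightarrow> 'v set \<Rightarrow> 'v set set" where
  "Sigma_node G A B = {I \<in> Ind G. A \<subseteq> I \<and> B \<inter> I = {}}"

text \<open>A tree records only the vertices used at each node; the labels \<open>Sigma_node G A B\<close> are
  recomputed from the root \<open>A = B = {}\<close>. \<open>Free p\<close> is rule (1) (its child has label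
  \<open>{}\<close>), \<open>Pendant p v t\<close> is rule (2), and \<open>Split v t u\<close> is rule (3), with \<open>t\<close> below the
  child excluding \<open>v\<close> and \<open>u\<close> below the child including \<open>v\<close>.\<close>

datatype 'v mtree =
    Stop
  | Free 'v
  | Pendant 'v 'v "'v mtree"
  | Split 'v "'v mtree" "'v mtree"

fun matching_tree_at :: "'v graph \<Rightarrow> 'v set \<Rightarrow> 'v set \<Rightarrow> 'v mtree \<Rightarrow> bool" where
  "matching_tree_at G A B Stop \<longleftrightarrow> card (Sigma_node G A B) \<le> 1"
| "matching_tree_at G A B (Free p) \<longleftrightarrow>
     2 \<le> card (Sigma_node G A B) \<and>
     p \<in> fst G - (A \<union> B) \<and> nbrs G p - (A \<union> B) = {}"
| "matching_tree_at G A B (Pendant p v t) \<longleftrightarrow>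
     2 \<le> card (Sigma_node G A B) \<and>
     p \<in> fst G - (A \<union> B) \<and> nbrs G p - (A \<union> B) = {v} \<and>
     matching_tree_at G (insert v A) (B \<union> nbrs G v) t"
| "matching_tree_at G A B (Split v t u) \<longleftrightarrow>
     2 \<le> card (Sigma_node G A B) \<and>
     v \<in> fst G - (A \<union> B) \<and>
     matching_tree_at G A (insert v B) t \<and>
     matching_tree_at G (insert v A) (B \<union> nbrs G v) u"

fun critical_cells_at :: "'v graph \<Rightarrow> 'v set \<Rightarrow> 'v set \<Rightarrow> 'v mtree \<Rightarrow> 'v set set" where
  "critical_cells_at G A B Stop = (if Sigma_node G A B = {} then {} else {A})"
| "critical_cells_at G A B (Free p) = {}"
| "critical_cells_at G A B (Pendant p v t) =
     critical_cells_at G (insert v A) (B \<union> nbrs G v) t"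
| "critical_cells_at G A B (Split v t u) =
     critical_cells_at G A (insert v B) t \<union>
     critical_cells_at G (insert v A) (B \<union> nbrs G v) u"

abbreviation matching_tree :: "'v graph \<Rightarrow> 'v mtree \<Rightarrow> bool" where
  "matching_tree G \<equiv> matching_tree_at G {} {}"

abbreviation critical_cells :: "'v graph \<Rightarrow> 'v mtree \<Rightarrow> 'v set set" where
  "critical_cells G \<equiv> critical_cells_at G {} {}"


section \<open>The Comb Algorithm\<close>

text \<open>The tree of a disjoint union of paths, each given as the list of its vertices; it
  processes the paths in turn, starting from the head of each list, and continues with \<open>t\<close>
  when no vertex of the paths is left.\<close>

fun path_tree :: "'v list \<Rightarrow> 'v mtree \<Rightarrow> 'v mtree" where
  "path_tree [] t = t"
| "path_tree [x] t = Free x"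
| "path_tree (x # y # zs) t = Pendant x y (path_tree (tl zs) t)"

definition paths_tree :: "'v list list \<Rightarrow> 'v mtree \<Rightarrow> 'v mtree" where
  "paths_tree ps t = foldr path_tree ps t"

definition tendrils :: "nat \<Rightarrow> nat \<Rightarrow> vertex list list" where
  "tendrils m n = map (\<lambda>j. map (Pt j) [1..<n + 1]) [1..<m + 1]"

text \<open>The tree of $Y^m_n$ centred at $a$, continued with \<open>t\<close> below the nonempty leaves.\<close>

definition star_tree :: "nat \<Rightarrow> nat \<Rightarrow> vertex mtree \<Rightarrow> vertex mtree" where
  "star_tree m n t =
    (if n mod 3 = 0 then paths_tree (map rev (tendrils m n)) (Free VA)
     else Split VA (paths_tree (tendrils m n) t) (paths_tree (map tl (tendrils m n)) t))"

definition hat_Y_tree :: "nat \<Rightarrow> nat \<Rightarrow> vertex mtree" where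
  "hat_Y_tree m n = Split VB (star_tree m n Stop) (star_tree m (n - 1) Stop)"

text \<open>Once $1, \dots, k - 1$ are excluded and $k$ is included, the available copy of
  $\Delta^m_{n-(k+1)}$ has the vertex $k + 1$ in the role of $a$ and $b$ in the role of $b$;
  \<open>shift (k + 1)\<close> is this identification.\<close>

fun shift :: "nat \<Rightarrow> vertex \<Rightarrow> vertex" where
  "shift s VA = Mid s"
| "shift s VB = VB"
| "shift s (Mid i) = Mid (s + i)"
| "shift s (Pt j i) = Pt j (s + i)"

text \<open>The successive splittings at $1, \dots, n$ form the spine of the tree. For \<open>n = 0\<close> the
  equation reduces to the tree of $\widehat Y^m_1$, as required by the recursive calls.\<close>

function comb_tree :: "nat \<Rightarrow> nat \<Rightarrow> vertex mtree" where
  "comb_tree m n =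
    foldr (\<lambda>k t. Split (Mid k) t
             (if k = 1 then Free VA
              else if k < n then
                star_tree m (k - 1) (map_mtree (shift (k + 1)) (comb_tree m (n - (k + 1))))
              else Free VB))
      [1..<n + 1] (hat_Y_tree m (n + 1))"
  by pat_completeness auto
termination
  by (relation "measure snd") auto

declare comb_tree.simps [simp del]


section \<open>Cell numbers and the reduced Euler characteristic\<close>

text \<open>The number of \<open>d\<close>-cells of $X^m_n$. For \<open>n \<ge> 1\<close> these are the critical cells of dimension
  \<open>d\<close> and one additional base \<open>0\<close>-cell; $X^m_0$ is $S^0$ with two \<open>0\<close>-cells.\<close>

definition num_cells :: "nat \<Rightarrow> nat \<Rightarrow> nat \<Rightarrow> nat" where
  "num_cells m n d =
    (if n = 0 then (if d = 0 then 2 else 0)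
     else card {I \<in> critical_cells (Delta m n) (comb_tree m n). face_dim I = int d}
          + (if d = 0 then 1 else 0))"

definition C :: "nat \<Rightarrow> nat \<Rightarrow> nat \<Rightarrow> int" where
  "C m n d = int (num_cells m n d) - (if d = 0 then 1 else 0)"

text \<open>\<open>Sum_any\<close> sums over the (finite) set of all \<open>d\<close> whose summand is nonzero.\<close>

definition chi :: "nat \<Rightarrow> nat \<Rightarrow> int" where
  "chi m n = Sum_any (\<lambda>d. (- 1) ^ d * C m n d)"


section \<open>The Comb Algorithm produces matching trees\<close>

text \<open>Neither \<open>comb_tree\<close> nor \<open>critical_cells\<close> mentions the side conditions of rules (1)-(3) or
  the requirement that every leaf be processed until it has at most one element. Theorem
  \<open>comb_tree_is_matching_tree\<close> shows that they hold. \<open>tree_on N W\<close> is the corresponding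
  condition in terms of the vertex set \<open>W\<close> of the available graph.\<close>

fun tree_on :: "('v \<Rightarrow> 'v set) \<Rightarrow> 'v set \<Rightarrow> 'v mtree \<Rightarrow> bool" where
  "tree_on N W Stop \<longleftrightarrow> W = {}"
| "tree_on N W (Free p) \<longleftrightarrow> p \<in> W \<and> N p \<inter> W = {}"
| "tree_on N W (Pendant p v t) \<longleftrightarrow> p \<in> W \<and> N p \<inter> W = {v} \<and> tree_on N (W - insert v (N v)) t"
| "tree_on N W (Split v t u) \<longleftrightarrow> v \<in> W \<and> tree_on N (W - {v}) t \<and> tree_on N (W - insert v (N v)) u"

lemma tree_on_matching:
  assumes fin: "finite (fst G)" and nb: "\<And>x. nbrs G x \<subseteq> fst G" and irr: "\<And>x. x \<notin> nbrs G x"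
  shows "tree_on (nbrs G) (fst G - (A \<union> B)) T \<Longrightarrow> A \<in> Ind G \<Longrightarrow> A \<inter> B = {}
    \<Longrightarrow> (\<forall>a\<in>A. nbrs G a \<subseteq> B) \<Longrightarrow> B \<subseteq> fst G \<Longrightarrow> matching_tree_at G A B T"
proof (induction T arbitrary: A B)
  have sym: "y \<in> nbrs G x \<longleftrightarrow> x \<in> nbrs G y" for x y
    by (simp add: nbrs_def insert_commute)
  have finS: "finite (Sigma_node G A B)" for A B
    by (rule finite_subset[of _ "Pow (fst G)"]) (auto simp: Sigma_node_def Ind_def fin)
  have ins: "insert w A \<in> Ind G \<and> A \<inter> insert w {} = {}"
    if "w \<in> fst G - (A \<union> B)" "A \<in> Ind G" "\<forall>a\<in>A. nbrs G a \<subseteq> B" for w A B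
  proof -
    have "w \<notin> nbrs G a" "a \<notin> nbrs G w" if "a \<in> A" for a
      using that \<open>\<forall>a\<in>A. nbrs G a \<subseteq> B\<close> \<open>w \<in> fst G - (A \<union> B)\<close> sym[of a w] by auto
    then show ?thesis using that irr[of w] by (auto simp: Ind_def nbrs_def)
  qed
  have two: "2 \<le> card (Sigma_node G A B)"
    if "w \<in> fst G - (A \<union> B)" "A \<in> Ind G" "A \<inter> B = {}" "\<forall>a\<in>A. nbrs G a \<subseteq> B" for w A B
  proof -
    have "{A, insert w A} \<subseteq> Sigma_node G A B"
      using that ins[OF that(1,2,4)] by (auto simp: Sigma_node_def)
    moreover have "A \<noteq> insert w A" using that by auto
    then have "card {A, insert w A} = 2" by simp
    ultimately show ?thesis using card_mono[OF finS] by metis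
  qed
  { case Stop
    then have "Sigma_node G A B \<subseteq> {A}" by (auto simp: Sigma_node_def Ind_def)
    then show ?case using card_mono[of "{A}" "Sigma_node G A B"] by simp
  next
    case (Free p)
    then show ?case using two[of p] nb[of p] by auto
  next
    case (Pendant p v T)
    have v: "v \<in> fst G - (A \<union> B)" using Pendant.prems by auto
    have av: "a \<notin> nbrs G v" if "a \<in> A" for a
      using that Pendant.prems v sym[of a v] by auto
    have "fst G - (insert v A \<union> (B \<union> nbrs G v)) = fst G - (A \<union> B) - insert v (nbrs G v)" by auto
    then have "matching_tree_at G (insert v A) (B \<union> nbrs G v) T"
      using Pendant.prems ins[OF v] nb[of v] v av irr[of v] by (intro Pendant.IH) auto
    moreover have "nbrs G p - (A \<union> B) = {v}"
      using Pendant.prems nb[of p] by auto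
    ultimately show ?case using Pendant.prems two[of p A B] by simp
  next
    case (Split v T U)
    have v: "v \<in> fst G - (A \<union> B)" using Split.prems by auto
    have av: "a \<notin> nbrs G v" if "a \<in> A" for a
      using that Split.prems v sym[of a v] by auto
    have "fst G - (insert v A \<union> (B \<union> nbrs G v)) = fst G - (A \<union> B) - insert v (nbrs G v)" by auto
    then have "matching_tree_at G (insert v A) (B \<union> nbrs G v) U"
      using Split.prems ins[OF v] nb[of v] v av irr[of v] by (intro Split.IH(2)) auto
    moreover have "fst G - (A \<union> insert v B) = fst G - (A \<union> B) - {v}" by auto
    then have "matching_tree_at G A (insert v B) T"
      using Split.prems v by (intro Split.IH(1)) auto
    ultimately show ?case using Split.prems two[of v A B] by simp
  }
qed

lemma tree_on_map:
  assumes "\<And>x. x \<in> W \<Longrightarrow> N' (\<phi> x) \<inter> \<phi> ` W = \<phi> ` (N x \<inter> W)" "inj_on \<phi> W" "tree_on N W T"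
  shows "tree_on N' (\<phi> ` W) (map_mtree \<phi> T)"
  using assms
proof (induction T arbitrary: W)
  case Stop then show ?case by simp
next
  case (Free p) then show ?case by simp
next
  case (Pendant p v T)
  have v: "v \<in> W" "p \<in> W" using Pendant.prems by auto
  let ?W = "W - insert v (N v)"
  have eq: "\<phi> ` W - insert (\<phi> v) (N' (\<phi> v)) = \<phi> ` ?W"
  proof -
    have "\<phi> ` W - insert (\<phi> v) (N' (\<phi> v)) = \<phi> ` W - insert (\<phi> v) (\<phi> ` (N v \<inter> W))"
      using Pendant.prems(1)[OF v(1)] by blast
    also have "\<dots> = \<phi> ` W - \<phi> ` (insert v (N v \<inter> W))" by simp
    also have "\<dots> = \<phi> ` (W - insert v (N v \<inter> W))"
      using Pendant.prems(2) v by (intro inj_on_image_set_diff[symmetric]) auto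
    also have "W - insert v (N v \<inter> W) = ?W" by auto
    finally show ?thesis .
  qed
  have "tree_on N' (\<phi> ` ?W) (map_mtree \<phi> T)"
  proof (rule Pendant.IH)
    show "N' (\<phi> x) \<inter> \<phi> ` ?W = \<phi> ` (N x \<inter> ?W)" if "x \<in> ?W" for x
    proof -
      have "N' (\<phi> x) \<inter> \<phi> ` ?W = (N' (\<phi> x) \<inter> \<phi> ` W) \<inter> \<phi> ` ?W" by auto
      also have "\<dots> = \<phi> ` (N x \<inter> W) \<inter> \<phi> ` ?W" using Pendant.prems(1)[of x] that by auto
      also have "\<dots> = \<phi> ` ((N x \<inter> W) \<inter> ?W)"
        by (rule inj_on_image_Int[symmetric, OF Pendant.prems(2)]) auto
      finally show ?thesis by (simp add: Int_assoc Int_absorb1)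
    qed
  qed (use Pendant.prems in \<open>auto intro: inj_on_subset\<close>)
  then show ?case using Pendant.prems v eq by auto
next
  case (Split v T U)
  have v: "v \<in> W" using Split.prems by auto
  let ?W = "W - insert v (N v)"
  have eq: "\<phi> ` W - insert (\<phi> v) (N' (\<phi> v)) = \<phi> ` ?W"
  proof -
    have "\<phi> ` W - insert (\<phi> v) (N' (\<phi> v)) = \<phi> ` W - insert (\<phi> v) (\<phi> ` (N v \<inter> W))"
      using Split.prems(1)[OF v(1)] by blast
    also have "\<dots> = \<phi> ` W - \<phi> ` (insert v (N v \<inter> W))" by simp
    also have "\<dots> = \<phi> ` (W - insert v (N v \<inter> W))"
      using Split.prems(2) v by (intro inj_on_image_set_diff[symmetric]) auto
    also have "W - insert v (N v \<inter> W) = ?W" by auto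
    finally show ?thesis .
  qed
  have loc: "N' (\<phi> x) \<inter> \<phi> ` W' = \<phi> ` (N x \<inter> W')" if "x \<in> W'" "W' \<subseteq> W" for x W'
  proof -
    have "N' (\<phi> x) \<inter> \<phi> ` W' = (N' (\<phi> x) \<inter> \<phi> ` W) \<inter> \<phi> ` W'" using that by auto
    also have "\<dots> = \<phi> ` (N x \<inter> W) \<inter> \<phi> ` W'" using Split.prems(1)[of x] that by auto
    also have "\<dots> = \<phi> ` ((N x \<inter> W) \<inter> W')"
      by (rule inj_on_image_Int[symmetric, OF Split.prems(2)]) (use that in auto)
    finally show ?thesis using that by (simp add: Int_assoc Int_absorb1)
  qed
  have "tree_on N' (\<phi> ` ?W) (map_mtree \<phi> U)"
    by (rule Split.IH(2)) (use Split.prems loc in \<open>auto intro: inj_on_subset\<close>)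
  moreover have "tree_on N' (\<phi> ` (W - {v})) (map_mtree \<phi> T)"
    by (rule Split.IH(1)) (use Split.prems loc in \<open>auto intro: inj_on_subset\<close>)
  moreover have "\<phi> ` (W - {v}) = \<phi> ` W - {\<phi> v}"
    using Split.prems(2) v inj_on_image_set_diff[of \<phi> W W "{v}"] by auto
  ultimately show ?case using Split.prems v eq by auto
qed

definition path_in :: "('v \<Rightarrow> 'v set) \<Rightarrow> 'v set \<Rightarrow> 'v list \<Rightarrow> bool" where
  "path_in N W xs \<longleftrightarrow> distinct xs \<and> set xs \<inter> W = {} \<and>
     (\<forall>i<length xs. i mod 3 \<noteq> 2 \<longrightarrow> N (xs ! i) \<inter> W = {}) \<and>
     (\<forall>i<length xs. \<forall>j<length xs. xs ! j \<in> N (xs ! i) \<longleftrightarrow> j = i + 1 \<or> i = j + 1)"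

lemma tree_on_path:
  "path_in N W xs \<Longrightarrow> tree_on N W t \<Longrightarrow> tree_on N (set xs \<union> W) (path_tree xs t)"
proof (induction xs t rule: path_tree.induct)
  case (1 t)
  then show ?case by simp
next
  case (2 x t)
  then show ?case by (auto simp: path_in_def)
next
  case (3 x y zs t)
  let ?xs = "x # y # zs"
  note p = 3(2)[unfolded path_in_def]
  have adj: "?xs ! j \<in> N (?xs ! i) \<longleftrightarrow> j = i + 1 \<or> i = j + 1"
    if "i < length ?xs" "j < length ?xs" for i j
    using p that by blast
  have W: "N (?xs ! i) \<inter> W = {}" if "i < length ?xs" "i mod 3 \<noteq> 2" for i
    using p that by blast
  have NW: "N x \<inter> W = {}" "N y \<inter> W = {}" using W[of 0] W[of 1] by auto
  have xx: "x \<notin> N x" "y \<in> N x" "x \<in> N y" "y \<notin> N y"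
    using adj[of 0 0] adj[of 0 1] adj[of 1 0] adj[of 1 1] by auto
  have xz: "z \<notin> N x" if z: "z \<in> set zs" for z
  proof -
    obtain k where "k < length zs" "z = zs ! k" using z by (auto simp: in_set_conv_nth)
    then show ?thesis using adj[of 0 "k + 2"] by auto
  qed
  have yz: "zs ! k \<in> N y \<longleftrightarrow> k = 0" if "k < length zs" for k
    using adj[of 1 "k + 2"] that by auto
  have yt: "z \<notin> N y" if z: "z \<in> set (tl zs)" for z
  proof -
    obtain k where "k < length (tl zs)" "z = tl zs ! k"
      using z by (auto simp: in_set_conv_nth)
    then have "Suc k < length zs" "z = zs ! Suc k" by (simp_all add: nth_tl)
    then show ?thesis using yz[of "Suc k"] by auto
  qed
  have dis: "distinct ?xs" "set ?xs \<inter> W = {}" using p by auto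
  have rest: "set ?xs \<union> W - insert y (N y) = set (tl zs) \<union> W"
  proof (cases zs)
    case Nil
    then show ?thesis using dis NW xx by auto
  next
    case (Cons z zs')
    then have "z \<in> N y" using yz[of 0] by auto
    then show ?thesis using dis NW xx yt Cons by auto
  qed
  have "path_in N W (tl zs)"
    unfolding path_in_def
  proof (intro conjI allI impI)
    show "distinct (tl zs)" "set (tl zs) \<inter> W = {}"
      using dis by (auto simp: distinct_tl dest: list.set_sel(2) intro: ccontr) (cases zs; auto)+
    fix i assume i: "i < length (tl zs)"
    have nth: "tl zs ! i = ?xs ! (i + 3)" if "i < length (tl zs)" for i
      using that by (simp add: nth_tl numeral_3_eq_3)
    { assume "i mod 3 \<noteq> 2"
      then show "N (tl zs ! i) \<inter> W = {}" using W[of "i + 3"] i nth by simp }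
    { fix j assume "j < length (tl zs)"
      then show "tl zs ! j \<in> N (tl zs ! i) \<longleftrightarrow> j = i + 1 \<or> i = j + 1"
        using adj[of "i + 3" "j + 3"] i nth by simp }
  qed
  then have "tree_on N (set (tl zs) \<union> W) (path_tree (tl zs) t)" using 3 by blast
  moreover have "N x \<inter> (set ?xs \<union> W) = {y}" using xx xz NW by auto
  ultimately show ?case using rest by simp
qed

lemma tree_on_paths:
  assumes "distinct js" "tree_on N W t"
    and "\<And>j. j \<in> set js \<Longrightarrow> path_in N W (f j)"
    and "\<And>j k x y. j \<in> set js \<Longrightarrow> k \<in> set js \<Longrightarrow> j \<noteq> k \<Longrightarrow> x \<in> set (f j) \<Longrightarrow> y \<in> set (f k)
        \<Longrightarrow> x \<noteq> y \<and> y \<notin> N x"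
  shows "tree_on N ((\<Union>j\<in>set js. set (f j)) \<union> W) (paths_tree (map f js) t)"
  using assms
proof (induction js)
  case Nil
  then show ?case by (simp add: paths_tree_def)
next
  case (Cons j js)
  let ?U = "(\<Union>j\<in>set js. set (f j)) \<union> W"
  have "tree_on N ?U (paths_tree (map f js) t)"
    using Cons.prems(1,2)
    by (intro Cons.IH Cons.prems(3,4)) auto
  moreover have "path_in N ?U (f j)"
  proof -
    have 1: "path_in N W (f j)" using Cons by simp
    have 2: "x \<notin> (\<Union>j\<in>set js. set (f j)) \<and> N x \<inter> (\<Union>j\<in>set js. set (f j)) = {}" if "x \<in> set (f j)" for x
    proof -
      have "x \<noteq> y \<and> y \<notin> N x" if "k \<in> set js" "y \<in> set (f k)" for k y
        using Cons.prems(1) Cons.prems(4)[of j k x y] that \<open>x \<in> set (f j)\<close> by auto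
      then show ?thesis by blast
    qed
    have "set (f j) \<inter> ?U = {}" using 1 2 unfolding path_in_def by blast
    moreover have "N (f j ! i) \<inter> ?U = {}" if "i < length (f j)" "i mod 3 \<noteq> 2" for i
      using 1 2[of "f j ! i"] that unfolding path_in_def by (simp add: Int_Un_distrib)
    ultimately show ?thesis using 1 unfolding path_in_def by blast
  qed
  ultimately have "tree_on N (set (f j) \<union> ?U) (path_tree (f j) (paths_tree (map f js) t))"
    by (rule tree_on_path[rotated])
  then show ?case by (simp add: paths_tree_def Un_assoc)
qed

lemma nbrs_Delta_iff:
  "q \<in> nbrs (Delta m n) p \<longleftrightarrow>
    (\<exists>j\<in>{1..m}. \<exists>k\<le>n+1. p = path_vertex (n+1) j k \<and> q = path_vertex (n+1) j (k+1)
        \<or> q = path_vertex (n+1) j k \<and> p = path_vertex (n+1) j (k+1)) \<or>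
    (\<exists>j\<in>{1..m}. \<exists>k\<in>{1..n}. p = Mid k \<and> (q = Pt j k \<or> q = Pt j (k+1))
        \<or> q = Mid k \<and> (p = Pt j k \<or> p = Pt j (k+1)))"
  unfolding nbrs_def Delta_def hat_Y_def
  by (simp add: doubleton_eq_iff) (rule iffI; elim disjE conjE exE; fastforce)

lemma nbrs_Delta:
  "VA \<notin> nbrs (Delta m n) VA" "VA \<notin> nbrs (Delta m n) VB" "VA \<notin> nbrs (Delta m n) (Mid k)"
  "VB \<notin> nbrs (Delta m n) VA" "VB \<notin> nbrs (Delta m n) VB" "VB \<notin> nbrs (Delta m n) (Mid k)"
  "Mid l \<notin> nbrs (Delta m n) VA" "Mid l \<notin> nbrs (Delta m n) VB" "Mid l \<notin> nbrs (Delta m n) (Mid k)"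
  "VA \<in> nbrs (Delta m n) (Pt j i) \<longleftrightarrow> j \<in> {1..m} \<and> i = 1"
  "VB \<in> nbrs (Delta m n) (Pt j i) \<longleftrightarrow> j \<in> {1..m} \<and> i = n + 1"
  "Mid k \<in> nbrs (Delta m n) (Pt j i) \<longleftrightarrow> j \<in> {1..m} \<and> k \<in> {1..n} \<and> (i = k \<or> i = k + 1)"
  "Pt j i \<in> nbrs (Delta m n) VA \<longleftrightarrow> j \<in> {1..m} \<and> i = 1"
  "Pt j i \<in> nbrs (Delta m n) VB \<longleftrightarrow> j \<in> {1..m} \<and> i = n + 1"
  "Pt j i \<in> nbrs (Delta m n) (Mid k) \<longleftrightarrow> j \<in> {1..m} \<and> k \<in> {1..n} \<and> (i = k \<or> i = k + 1)"
  "Pt j' i' \<in> nbrs (Delta m n) (Pt j i) \<longleftrightarrow>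
     j' = j \<and> j \<in> {1..m} \<and> i \<in> {1..n+1} \<and> i' \<in> {1..n+1} \<and> (i' = i + 1 \<or> i = i' + 1)"
  unfolding nbrs_Delta_iff path_vertex_def
  apply (auto split: if_splits)
     apply (rule bexI[of _ j], rule exI[of _ "Suc n"]; simp)
    apply (rule bexI[of _ j], rule exI[of _ "Suc n"]; simp)
   apply (rule bexI[of _ j], rule exI[of _ i]; simp)
  apply (rule bexI[of _ j], rule exI[of _ i']; simp)
  done

lemma verts_Delta:
  "VA \<in> fst (Delta m n)" "VB \<in> fst (Delta m n)"
  "Mid k \<in> fst (Delta m n) \<longleftrightarrow> k \<in> {1..n}"
  "Pt j k \<in> fst (Delta m n) \<longleftrightarrow> j \<in> {1..m} \<and> k \<in> {1..n + 1}"
  by (auto simp: Delta_def hat_Y_def)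

lemma tree_on_star:
  assumes N: "N = nbrs (Delta m n)" and l: "l \<le> n + 1" and t: "tree_on N W t"
    and S: "S = insert VA {Pt j i | j i. j \<in> {1..m} \<and> i \<in> {1..l}}"
    and WS: "\<And>x y. x \<in> W \<Longrightarrow> y \<in> S \<Longrightarrow> x \<noteq> y \<and> x \<notin> N y"
  shows "tree_on N (S \<union> W) (star_tree m l t)"
proof -
  have VW: "VA \<notin> W" "N VA \<inter> W = {}" using WS by (auto simp: S)
  have PW: "Pt j i \<notin> W" "N (Pt j i) \<inter> W = {}" if "j \<in> {1..m}" "1 \<le> i" "i \<le> l" for j i
  proof -
    have "Pt j i \<in> S" using that by (auto simp: S)
    then show "Pt j i \<notin> W" "N (Pt j i) \<inter> W = {}" using WS by blast+
  qed
  have UN: "(\<Union>j\<in>set [1..<m+1]. set (map (Pt j) [s..<l+1])) = {Pt j i | j i. j \<in> {1..m} \<and> i \<in> {s..l}}" for s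
  proof -
    have "set [1..<m+1] = {1..m}" "set [s..<l+1] = {s..l}" by auto
    then show ?thesis unfolding set_map by blast
  qed
  show ?thesis
  proof (cases "l mod 3 = 0")
    case True
    have "tree_on N ((\<Union>j\<in>set [1..<m+1]. set (rev (map (Pt j) [1..<l+1]))) \<union> insert VA W)
       (paths_tree (map (\<lambda>j. rev (map (Pt j) [1..<l+1])) [1..<m+1]) (Free VA))"
    proof (rule tree_on_paths)
      show "tree_on N (insert VA W) (Free VA)" using VW by (simp add: N nbrs_Delta)
      fix j assume "j \<in> set [1..<m+1]"
      then have j: "j \<in> {1..m}" by auto
      have nth: "rev (map (Pt j) [1..<l+1]) ! i = Pt j (l - i)" if "i < l" for i
        using that by (simp add: rev_nth del: upt_Suc)
      have len: "length (rev (map (Pt j) [1..<l+1])) = l" by simp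
      show "path_in N (insert VA W) (rev (map (Pt j) [1..<l+1]))"
        unfolding path_in_def len
      proof (intro conjI allI impI)
        show "distinct (rev (map (Pt j) [1..<l+1]))"
          by (simp add: distinct_map inj_on_def del: upt_Suc)
        show "set (rev (map (Pt j) [1..<l+1])) \<inter> insert VA W = {}"
          using PW(1)[OF j] by (auto simp del: upt_Suc)
        fix i assume i: "i < l"
        then have *: "N (Pt j (l - i)) \<inter> W = {}" using PW(2)[OF j] by simp
        { assume "i mod 3 \<noteq> 2"
          then have "l - i \<noteq> 1" using True i by presburger
          then show "N (rev (map (Pt j) [1..<l+1]) ! i) \<inter> insert VA W = {}"
            using * nth[OF i] by (simp add: N nbrs_Delta del: upt_Suc) }
        { fix k assume k: "k < l"
          show "rev (map (Pt j) [1..<l+1]) ! k \<in> N (rev (map (Pt j) [1..<l+1]) ! i)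
            \<longleftrightarrow> k = i + 1 \<or> i = k + 1"
            using nth[OF i] nth[OF k] i k l j by (auto simp: N nbrs_Delta simp del: upt_Suc) }
      qed
    qed (auto simp: N nbrs_Delta simp del: upt_Suc)
    moreover have "(\<Union>j\<in>set [1..<m+1]. set (rev (map (Pt j) [1..<l+1]))) \<union> insert VA W = S \<union> W"
      unfolding set_rev UN S by blast
    moreover have "map rev (tendrils m l) = map (\<lambda>j. rev (map (Pt j) [1..<l+1])) [1..<m+1]"
      by (simp add: tendrils_def del: upt_Suc)
    ultimately show ?thesis using True by (simp add: star_tree_def del: upt_Suc)
  next
    case False
    have main: "tree_on N ((\<Union>j\<in>set [1..<m+1]. set (map (Pt j) [s..<l+1])) \<union> W)
       (paths_tree (map (\<lambda>j. map (Pt j) [s..<l+1]) [1..<m+1]) t)" if s: "s \<ge> 1" for s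
    proof (rule tree_on_paths)
      fix j assume "j \<in> set [1..<m+1]"
      then have j: "j \<in> {1..m}" by auto
      let ?xs = "map (Pt j) [s..<l+1]"
      have nth: "?xs ! i = Pt j (s + i)" if "i < l + 1 - s" for i
        using that by (simp del: upt_Suc)
      have len: "length ?xs = l + 1 - s" by (simp del: upt_Suc)
      show "path_in N W ?xs"
        unfolding path_in_def len
      proof (intro conjI allI impI)
        show "distinct ?xs" by (simp add: distinct_map inj_on_def del: upt_Suc)
        show "set ?xs \<inter> W = {}"
          using PW(1)[OF j] s by (auto simp del: upt_Suc)
        fix i assume i: "i < l + 1 - s"
        then show "N (?xs ! i) \<inter> W = {}" using PW(2)[OF j, of "s + i"] s nth[OF i]
          by (simp del: upt_Suc)
        fix k assume k: "k < l + 1 - s"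
        show "?xs ! k \<in> N (?xs ! i) \<longleftrightarrow> k = i + 1 \<or> i = k + 1"
          using nth[OF i] nth[OF k] i k l j s by (auto simp: N nbrs_Delta simp del: upt_Suc)
      qed
    qed (use t in \<open>auto simp: N nbrs_Delta simp del: upt_Suc\<close>)
    have e1: "S \<union> W - {VA} = (\<Union>j\<in>set [1..<m+1]. set (map (Pt j) [1..<l+1])) \<union> W"
      unfolding UN S using VW by blast
    have e2: "S \<union> W - insert VA (N VA) = (\<Union>j\<in>set [1..<m+1]. set (map (Pt j) [2..<l+1])) \<union> W"
    proof -
      have "x \<notin> N VA" if "x \<in> W" for x using VW that by auto
      then show ?thesis unfolding UN S using VW(1) by (auto simp: N nbrs_Delta)
    qed
    have tl: "map tl (tendrils m l) = map (\<lambda>j. map (Pt j) [2..<l+1]) [1..<m+1]"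
      by (simp add: tendrils_def map_tl[symmetric] numeral_2_eq_2 del: upt_Suc)
    have "VA \<in> S \<union> W" by (simp add: S)
    then show ?thesis
      unfolding star_tree_def if_not_P[OF False] tl
      unfolding tendrils_def tree_on.simps e1 e2
      using main[OF order_refl] main[OF one_le_numeral] by blast
  qed
qed

lemma tree_on_hat_Y:
  assumes N: "N = nbrs (Delta m n)"
  shows "tree_on N (fst (hat_Y m (n + 1))) (hat_Y_tree m (n + 1))"
proof -
  have st: "tree_on N (insert VA {Pt j i | j i. j \<in> {1..m} \<and> i \<in> {1..l}}) (star_tree m l Stop)"
    if "l \<le> n + 1" for l
    using tree_on_star[OF N that, of "{}" Stop] by simp
  have "fst (hat_Y m (n + 1)) - {VB} = insert VA {Pt j i | j i. j \<in> {1..m} \<and> i \<in> {1..n+1}}"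
    by (auto simp: hat_Y_def)
  moreover have "fst (hat_Y m (n + 1)) - insert VB (N VB) = insert VA {Pt j i | j i. j \<in> {1..m} \<and> i \<in> {1..n}}"
    by (auto simp: hat_Y_def N nbrs_Delta)
  ultimately show ?thesis using st[of "n+1"] st[of n] by (simp add: hat_Y_tree_def hat_Y_def)
qed

lemma tree_on_comb: "tree_on (nbrs (Delta m n)) (fst (Delta m n)) (comb_tree m n)"
proof (induction n rule: less_induct)
  case (less n)
  let ?N = "nbrs (Delta m n)"
  let ?H = "fst (hat_Y m (n + 1))"
  let ?br = "\<lambda>k. if k = 1 then Free VA
              else if k < n then
                star_tree m (k - 1) (map_mtree (shift (k + 1)) (comb_tree m (n - (k + 1))))
              else Free VB"
  have br: "tree_on ?N (?H \<union> Mid ` {k..n} - insert (Mid k) (?N (Mid k))) (?br k)"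
    if k: "1 \<le> k" "k \<le> n" for k
  proof -
    consider "k = 1" | "k = n" "k \<noteq> 1" | "1 < k" "k < n" using k by linarith
    then show ?thesis
    proof cases
      case 1
      let ?U = "?H \<union> Mid ` {k..n} - insert (Mid k) (?N (Mid k))"
      have "x \<in> ?N (Mid k)" if "x \<in> ?N VA" for x
        using that 1 k by (cases x) (simp_all add: nbrs_Delta)
      then have "?N VA \<inter> ?U = {}" by blast
      moreover have "VA \<in> ?U" by (simp add: hat_Y_def nbrs_Delta)
      ultimately show ?thesis unfolding if_P[OF 1] tree_on.simps by blast
    next
      case 2
      then show ?thesis using k by (auto simp: hat_Y_def nbrs_Delta)
    next
      case 3
      define n' where "n' = n - (k + 1)"
      have n': "n = n' + (k + 1)" using 3 by (simp add: n'_def)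
      let ?W = "shift (k + 1) ` fst (Delta m n')"
      have inj: "inj_on (shift (k + 1)) (fst (Delta m n'))"
      proof (rule inj_onI)
        fix x y assume "x \<in> fst (Delta m n')" "y \<in> fst (Delta m n')" "shift (k + 1) x = shift (k + 1) y"
        then show "x = y" by (cases x; cases y) (auto simp: Delta_def hat_Y_def)
      qed
      have t: "tree_on ?N ?W (map_mtree (shift (k + 1)) (comb_tree m n'))"
      proof (rule tree_on_map[OF _ inj])
        show "tree_on (nbrs (Delta m n')) (fst (Delta m n')) (comb_tree m n')"
          using less n' by simp
        fix x assume x: "x \<in> fst (Delta m n')"
        have "shift (k + 1) y \<in> ?N (shift (k + 1) x) \<longleftrightarrow> y \<in> nbrs (Delta m n') x"
          if "y \<in> fst (Delta m n')" for y
          using x that by (cases x; cases y) (auto simp: verts_Delta nbrs_Delta n')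
        then show "?N (shift (k + 1) x) \<inter> ?W = shift (k + 1) ` (nbrs (Delta m n') x \<inter> fst (Delta m n'))"
          by blast
      qed
      have W: "?W = {VB} \<union> {Pt j i | j i. j \<in> {1..m} \<and> i \<in> {k+2..n+1}} \<union> Mid ` {k+1..n}"
      proof -
        have "Pt j i \<in> ?W" if "j \<in> {1..m}" "i \<in> {k+2..n+1}" for j i
          using that n' by (intro image_eqI[of _ _ "Pt j (i - (k+1))"]) (auto simp: Delta_def hat_Y_def)
        moreover have "Mid i \<in> ?W" if "i \<in> {k+1..n}" for i
        proof (cases "i = k + 1")
          case True
          then show ?thesis by (intro image_eqI[of _ _ VA]) (auto simp: Delta_def hat_Y_def)
        next
          case False
          then show ?thesis using that n'
            by (intro image_eqI[of _ _ "Mid (i - (k+1))"]) (auto simp: Delta_def hat_Y_def)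
        qed
        moreover have "VB \<in> ?W" by (intro image_eqI[of _ _ VB]) (auto simp: Delta_def hat_Y_def)
        moreover have "?W \<subseteq> {VB} \<union> {Pt j i | j i. j \<in> {1..m} \<and> i \<in> {k+2..n+1}} \<union> Mid ` {k+1..n}"
          by (auto simp: Delta_def hat_Y_def n')
        ultimately show ?thesis by blast
      qed
      let ?S = "insert VA {Pt j i | j i. j \<in> {1..m} \<and> i \<in> {1..k-1}}"
      have WS: "x \<noteq> y \<and> x \<notin> ?N y" if "x \<in> ?W" "y \<in> ?S" for x y
        using that 3 unfolding W by (auto simp: nbrs_Delta)
      have "tree_on ?N (?S \<union> ?W)
          (star_tree m (k - 1) (map_mtree (shift (k + 1)) (comb_tree m n')))"
        by (rule tree_on_star[OF refl _ t refl WS]) (use 3 in simp_all)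
      moreover have "?H \<union> Mid ` {k..n} - insert (Mid k) (?N (Mid k)) = ?S \<union> ?W"
        unfolding W using 3 by (auto simp: hat_Y_def nbrs_Delta)
      ultimately show ?thesis using 3 by (simp add: n'_def)
    qed
  qed
  have "tree_on ?N (?H \<union> Mid ` {k..n}) (foldr (\<lambda>k t. Split (Mid k) t (?br k)) [k..<n+1] (hat_Y_tree m (n+1)))"
    if "1 \<le> k" "k \<le> n + 1" for k
    using that(2,1)
  proof (induction rule: inc_induct)
    case base
    then show ?case using tree_on_hat_Y[OF refl] by simp
  next
    case (step k)
    then have k: "k < n + 1" "1 \<le> k" by auto
    have "?H \<union> Mid ` {k..n} - {Mid k} = ?H \<union> Mid ` {Suc k..n}"
      using k by (auto simp: hat_Y_def)
    moreover have "Mid k \<in> ?H \<union> Mid ` {k..n}" using k by auto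
    moreover have "[k..<n+1] = k # [Suc k..<n+1]" using k by (simp add: upt_conv_Cons del: upt_Suc)
    ultimately show ?case using step br[of k] k by (simp del: upt_Suc)
  qed
  from this[of 1]
  have "tree_on ?N (?H \<union> Mid ` {1..n}) (comb_tree m n)"
    by (subst comb_tree.simps) (simp del: upt_Suc)
  moreover have "fst (Delta m n) = ?H \<union> Mid ` {1..n}"
    by (auto simp: Delta_def)
  ultimately show ?case by simp
qed

theorem comb_tree_is_matching_tree: "matching_tree (Delta m n) (comb_tree m n)"
proof (rule tree_on_matching)
  have "fst (Delta m n) = {VA, VB} \<union> (\<lambda>(j, k). Pt j k) ` ({1..m} \<times> {1..n+1}) \<union> Mid ` {1..n}"
    by (auto simp: Delta_def hat_Y_def)
  then show "finite (fst (Delta m n))"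
    by (simp only:) (intro finite_UnI finite_imageI finite_cartesian_product; simp)
  show "nbrs (Delta m n) x \<subseteq> fst (Delta m n)" for x
  proof
    fix y assume "y \<in> nbrs (Delta m n) x"
    then show "y \<in> fst (Delta m n)"
      by (cases x; cases y) (auto simp: nbrs_Delta verts_Delta)
  qed
  show "x \<notin> nbrs (Delta m n) x" for x by (cases x) (auto simp: nbrs_Delta)
  show "tree_on (nbrs (Delta m n)) (fst (Delta m n) - ({} \<union> {})) (comb_tree m n)"
    using tree_on_comb by simp
qed (auto simp: Ind_def)

end

theory Submission
  imports Defs
begin

text \<open>Rules (1)--(3) translate into the signed count \<open>Free = 0\<close>, \<open>Pendant t = - t\<close> and
  \<open>Split t u = t - u\<close> of the critical cells, so the Euler characteristic can be read off the tree
  without listing the cells. Processing a star multiplies this count by a factor $s_l$ with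
  $s_{l+3} = (-1)^m s_l$, and the spine of the comb gives
  $D_n = s_{n+1} - s_n - \sum_{j<n-2} s_{j+1} D_{n-3-j}$ for $D_n = -\chi^m_n$. Subtracting
  $(-1)^m D_{n-3}$ telescopes the sum down to the terms with $s_1$, $s_2$ and $s_3$.\<close>

section \<open>Signed counts of critical cells\<close>

primrec mtree_sign :: "'v mtree \<Rightarrow> int" where
  "mtree_sign Stop = 1"
| "mtree_sign (Free p) = 0"
| "mtree_sign (Pendant p v t) = - mtree_sign t"
| "mtree_sign (Split v t u) = mtree_sign t - mtree_sign u"

lemma mtree_sign_map: "mtree_sign (map_mtree f T) = mtree_sign T"
  by (induction T) auto

lemma finite_critical_cells: "finite (critical_cells_at G A B T)"
  by (induction T arbitrary: A B) auto

text \<open>On the way down vertices are only ever added to \<open>A\<close> and \<open>B\<close>.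
  The point is that the two branches of a split have no cell in common: one omits \<open>v\<close>,
  the other contains it.\<close>

lemma critical_cells_at_bounds:
  "I \<in> critical_cells_at G A B T \<Longrightarrow> A \<subseteq> I \<and> I \<inter> B = {}"
proof (induction T arbitrary: A B)
  case Stop
  then show ?case by (auto simp: Sigma_node_def split: if_splits)
next
  case (Free p)
  then show ?case by simp
next
  case (Pendant p v T)
  then show ?case using Pendant.IH[of "insert v A" "B \<union> nbrs G v"] by auto
next
  case (Split v T U)
  then consider "I \<in> critical_cells_at G A (insert v B) T"
    | "I \<in> critical_cells_at G (insert v A) (B \<union> nbrs G v) U" by auto
  then show ?case using Split.IH(1)[of A "insert v B"] Split.IH(2)[of "insert v A" "B \<union> nbrs G v"]
    by cases (simp; blast)+
qed

text \<open>By the side conditions of the rules each included vertex is new to \<open>A\<close>, so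
  it flips the sign exactly once. At \<open>Stop\<close> the invariants make \<open>A\<close> itself
  a face of the label, so the leaf contributes one cell.\<close>

lemma sum_critical_cells:
  assumes nb: "\<And>x. nbrs G x \<subseteq> fst G" and irr: "\<And>x. x \<notin> nbrs G x"
  shows "matching_tree_at G A B T \<Longrightarrow> A \<in> Ind G \<Longrightarrow> finite A \<Longrightarrow> A \<inter> B = {}
    \<Longrightarrow> (\<forall>a\<in>A. nbrs G a \<subseteq> B)
    \<Longrightarrow> (\<Sum>I\<in>critical_cells_at G A B T. (- 1) ^ card I) = (- 1) ^ card A * mtree_sign T"
proof (induction T arbitrary: A B)
  have sym: "y \<in> nbrs G x \<longleftrightarrow> x \<in> nbrs G y" for x y
    by (simp add: nbrs_def insert_commute)
  have ins: "insert v A \<in> Ind G" "insert v A \<inter> (B \<union> nbrs G v) = {}"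
      "\<forall>a\<in>insert v A. nbrs G a \<subseteq> B \<union> nbrs G v"
    if "v \<in> fst G" "v \<notin> A \<union> B" "A \<in> Ind G" "A \<inter> B = {}" "\<forall>a\<in>A. nbrs G a \<subseteq> B" for v A B
  proof -
    have a: "v \<notin> nbrs G a" "a \<notin> nbrs G v" if "a \<in> A" for a
      using that \<open>\<forall>a\<in>A. nbrs G a \<subseteq> B\<close> \<open>v \<notin> A \<union> B\<close> sym[of a v] by auto
    then show "insert v A \<in> Ind G" using that irr[of v] by (auto simp: Ind_def nbrs_def)
    show "insert v A \<inter> (B \<union> nbrs G v) = {}" using a that irr[of v] by auto
    show "\<forall>a\<in>insert v A. nbrs G a \<subseteq> B \<union> nbrs G v" using that by auto
  qed
  { case Stop
    then have "A \<in> Sigma_node G A B" by (auto simp: Sigma_node_def)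
    then show ?case by auto
  next
    case (Free p)
    then show ?case by simp
  next
    case (Pendant p v T)
    then have v: "v \<in> fst G" "v \<notin> A \<union> B" using nb[of p] by auto
    have "matching_tree_at G (insert v A) (B \<union> nbrs G v) T" "finite (insert v A)"
      "card (insert v A) = Suc (card A)"
      using Pendant.prems(1,3) v by simp_all
    then show ?case using Pendant.IH[OF _ ins(1)[OF v Pendant.prems(2,4,5)]]
      ins(2,3)[OF v Pendant.prems(2,4,5)] by simp
  next
    case (Split v T U)
    then have v: "v \<in> fst G" "v \<notin> A \<union> B" by auto
    have "critical_cells_at G A (insert v B) T \<inter>
        critical_cells_at G (insert v A) (B \<union> nbrs G v) U = {}"
      using critical_cells_at_bounds[of _ G A "insert v B" T]
        critical_cells_at_bounds[of _ G "insert v A" "B \<union> nbrs G v" U] by blast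
    then have "(\<Sum>I\<in>critical_cells_at G A B (Split v T U). (- 1) ^ card I) =
        (\<Sum>I\<in>critical_cells_at G A (insert v B) T. (- 1) ^ card I) +
        (\<Sum>I\<in>critical_cells_at G (insert v A) (B \<union> nbrs G v) U. (- 1 :: int) ^ card I)"
      by (simp add: sum.union_disjoint finite_critical_cells)
    moreover have "(\<Sum>I\<in>critical_cells_at G A (insert v B) T. (- 1) ^ card I) =
        (- 1) ^ card A * mtree_sign T"
      using v by (intro Split.IH(1)) (use Split.prems in auto)
    moreover have "(\<Sum>I\<in>critical_cells_at G (insert v A) (B \<union> nbrs G v) U. (- 1) ^ card I) =
        (- 1) ^ card (insert v A) * mtree_sign U"
      using Split.prems(1,3) ins[OF v Split.prems(2,4,5)] by (intro Split.IH(2)) simp_all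
    moreover have "card (insert v A) = Suc (card A)" using Split.prems v by simp
    ultimately show ?case by (simp add: algebra_simps)
  }
qed

text \<open>A critical empty face would have dimension \<open>-1\<close> and be missed by \<open>chi\<close>. It does not occur
  when the branch of a tree that always excludes the splitting vertex avoids \<open>Stop\<close>.\<close>

primrec matches_empty :: "'v mtree \<Rightarrow> bool" where
  "matches_empty Stop \<longleftrightarrow> False"
| "matches_empty (Free p) \<longleftrightarrow> True"
| "matches_empty (Pendant p v t) \<longleftrightarrow> True"
| "matches_empty (Split v t u) \<longleftrightarrow> matches_empty t"

text \<open>Every cell below an inclusion contains the included vertex, so only the successive
  exclusions need to be followed.\<close>

lemma empty_notin_critical_cells:
  "matches_empty T \<Longrightarrow> {} \<notin> critical_cells_at G A B T"
proof (induction T arbitrary: A B)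
  case (Pendant p v T)
  then show ?case using critical_cells_at_bounds[of "{}" G "insert v A"] by auto
next
  case (Split v T U)
  then show ?case using critical_cells_at_bounds[of "{}" G "insert v A"] by auto
qed auto

lemma matches_empty_path_tree: "xs \<noteq> [] \<Longrightarrow> matches_empty (path_tree xs t)"
  by (induction xs t rule: path_tree.induct) auto

text \<open>Since \<open>m\<close> and \<open>l\<close> are positive, the exclusion branch starts to
  process a nonempty tendril before it can reach \<open>t\<close>.\<close>

lemma matches_empty_star_tree:
  assumes "m \<ge> 1" "l \<ge> 1"
  shows "matches_empty (star_tree m l t)"
proof -
  have m: "[1..<m + 1] = 1 # [2..<m + 1]" using assms by (simp add: upt_conv_Cons numeral_2_eq_2 del: upt_Suc)
  have "[1..<l + 1] \<noteq> []" using assms by simp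
  then show ?thesis
    unfolding star_tree_def tendrils_def paths_tree_def m by (simp add: matches_empty_path_tree del: upt_Suc)
qed

lemma matches_empty_comb_tree:
  assumes "m \<ge> 1"
  shows "matches_empty (comb_tree m n)"
proof -
  have fold: "matches_empty (foldr (\<lambda>k t. Split (f k) t (g k)) ks t0) = matches_empty t0"
    for f :: "nat \<Rightarrow> vertex" and g ks t0
    by (induction ks) auto
  show ?thesis
    using assms by (subst comb_tree.simps) (simp add: fold hat_Y_tree_def matches_empty_star_tree del: upt_Suc)
qed

section \<open>Signs of paths and stars\<close>

text \<open>This is the independence polynomial of the path on \<open>k\<close> vertices, evaluated
  at -1.\<close>

definition path_sign :: "nat \<Rightarrow> int" where
  "path_sign k = (if k mod 3 = 1 then 0 else (- 1) ^ ((k + 1) div 3))"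

lemma path_sign_add3: "path_sign (k + 3) = - path_sign k"
proof -
  have "(k + 3 + 1) div 3 = Suc ((k + 1) div 3)" by simp
  then show ?thesis by (simp add: path_sign_def)
qed

lemma mtree_sign_path_tree: "mtree_sign (path_tree xs t) = path_sign (length xs) * mtree_sign t"
proof (induction xs t rule: path_tree.induct)
  case (3 x y zs t)
  have "path_sign (length (x # y # zs)) = - path_sign (length (tl zs))"
  proof (cases zs)
    \<comment> \<open>Here the pendant step uses up only two vertices: \<open>tl []\<close> is empty
      and \<open>path_sign 2 = - path_sign 0\<close>.\<close>
    case Nil
    then show ?thesis by (simp add: path_sign_def)
  next
    case (Cons z zs')
    then show ?thesis using path_sign_add3[of "length zs'"] by (simp add: numeral_3_eq_3)
  qed
  then show ?case using 3 by simp
qed (simp_all add: path_sign_def)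

lemma mtree_sign_paths_tree:
  assumes "\<And>xs. xs \<in> set ps \<Longrightarrow> length xs = l"
  shows "mtree_sign (paths_tree ps t) = path_sign l ^ length ps * mtree_sign t"
  using assms by (induction ps) (simp_all add: paths_tree_def mtree_sign_path_tree)

text \<open>The independence polynomial of $Y^m_l$ at -1: without the centre there remain
  \<open>m\<close> paths on \<open>l\<close> vertices, with it \<open>m\<close> paths on
  \<open>l - 1\<close>. The value 0 reflects the tree that ends in the free centre.\<close>

definition star_sign :: "nat \<Rightarrow> nat \<Rightarrow> int" where
  "star_sign m l = (if l mod 3 = 0 then 0 else path_sign l ^ m - path_sign (l - 1) ^ m)"

lemma mtree_sign_star_tree: "mtree_sign (star_tree m l t) = star_sign m l * mtree_sign t"
proof -
  have "mtree_sign (paths_tree (map rev (tendrils m l)) (Free VA)) = path_sign l ^ m * 0"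
    "mtree_sign (paths_tree (tendrils m l) t) = path_sign l ^ m * mtree_sign t"
    "mtree_sign (paths_tree (map tl (tendrils m l)) t) = path_sign (l - 1) ^ m * mtree_sign t"
    by (subst mtree_sign_paths_tree[where l = l] mtree_sign_paths_tree[where l = "l - 1"];
        auto simp: tendrils_def simp del: upt_Suc)+
  then show ?thesis by (simp add: star_tree_def star_sign_def algebra_simps)
qed

text \<open>Three more vertices on each of the \<open>m\<close> tendrils flip \<open>m\<close> path
  signs.\<close>

lemma star_sign_add3: "star_sign m (l + 3) = (- 1) ^ m * star_sign m l"
proof (cases "l mod 3 = 0")
  case True
  then show ?thesis by (simp add: star_sign_def)
next
  case False
  \<comment> \<open>Here \<open>l\<close> is positive, so the truncated subtraction commutes with
    the shift.\<close>
  then have "l + 3 - 1 = (l - 1) + 3" by (cases l) auto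
  then show ?thesis
    using False path_sign_add3[of l] path_sign_add3[of "l - 1"]
    by (simp add: star_sign_def power_minus[of "path_sign _"] right_diff_distrib)
qed

text \<open>Since \<open>path_sign 1 = 0\<close>, its \<open>m\<close>-th power vanishes for
  \<open>m \<ge> 1\<close>.\<close>

lemma star_sign_values:
  assumes "m \<ge> 1"
  shows "star_sign m 1 = - 1" "star_sign m 2 = (- 1) ^ m" "star_sign m 3 = 0"
  using assms by (simp_all add: star_sign_def path_sign_def power_0_left)

section \<open>The recurrence along the spine of the comb\<close>

text \<open>Including \<open>Mid k\<close> with \<open>1 < k < n\<close> leaves a star and a smaller
  comb, whose signs multiply; \<open>j\<close> is \<open>k - 2\<close>. The two star terms outside
  the sum come from splitting at \<open>VB\<close> at the end of the spine.\<close>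

lemma mtree_sign_comb_tree:
  "mtree_sign (comb_tree m n) = star_sign m (n + 1) - star_sign m n
     - (\<Sum>j<n - 2. star_sign m (j + 1) * mtree_sign (comb_tree m (n - 3 - j)))"
proof -
  have fold: "mtree_sign (foldr (\<lambda>k t. Split (f k) t (g k)) ks t0)
      = mtree_sign t0 - sum_list (map (\<lambda>k. mtree_sign (g k)) ks)"
    for f :: "nat \<Rightarrow> vertex" and g ks t0
    by (induction ks) auto
  let ?g = "\<lambda>k. if k = 1 then Free VA
              else if k < n then
                star_tree m (k - 1) (map_mtree (shift (k + 1)) (comb_tree m (n - (k + 1))))
              else Free VB"
  have "mtree_sign (comb_tree m n) =
      star_sign m (n + 1) - star_sign m n - sum_list (map (\<lambda>k. mtree_sign (?g k)) [1..<n + 1])"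
    by (subst comb_tree.simps) (simp only: fold, simp add: hat_Y_tree_def mtree_sign_star_tree)
  also have "sum_list (map (\<lambda>k. mtree_sign (?g k)) [1..<n + 1]) = (\<Sum>k\<in>{1..<n + 1}. mtree_sign (?g k))"
    by (simp only: interv_sum_list_conv_sum_set_nat set_upt)
  \<comment> \<open>The branches at \<open>k = 1\<close> and \<open>k = n\<close> end in a free
    vertex and have sign 0.\<close>
  also have "\<dots> = (\<Sum>k\<in>{2..<n}. star_sign m (k - 1) * mtree_sign (comb_tree m (n - (k + 1))))"
    by (rule sum.mono_neutral_cong_right) (auto simp: mtree_sign_star_tree mtree_sign_map)
  also have "\<dots> = (\<Sum>j<n - 2. star_sign m (j + 1) * mtree_sign (comb_tree m (n - 3 - j)))"
    by (rule sum.reindex_bij_witness[of _ "\<lambda>j. j + 2" "\<lambda>k. k - 2"])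
       (auto simp: numeral_2_eq_2 numeral_3_eq_3 Suc_diff_Suc)
  finally show ?thesis .
qed

lemma mtree_sign_comb_tree_rec:
  assumes "m \<ge> 1"
  shows "mtree_sign (comb_tree m (N + 4)) =
    (1 + (- 1) ^ m) * mtree_sign (comb_tree m (N + 1)) + (- 1) ^ (m + 1) * mtree_sign (comb_tree m N)"
proof -
  let ?s = "star_sign m" and ?D = "\<lambda>n. mtree_sign (comb_tree m n)"
  note s = star_sign_values[OF assms]
  \<comment> \<open>The term \<open>j = 0\<close> vanishes because \<open>?s 3 = 0\<close>; in the
    others the star index drops by three at the cost of a factor \<open>(- 1) ^ m\<close>.\<close>
  have tail: "(\<Sum>j<N. ?s (j + 3) * ?D (N - 1 - j)) = (- 1) ^ m * (\<Sum>j<N - 1. ?s (j + 1) * ?D (N - 2 - j))"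
  proof (cases N)
    case (Suc M)
    have "(\<Sum>j<N. ?s (j + 3) * ?D (N - 1 - j)) = (\<Sum>j<M. ?s ((j + 1) + 3) * ?D (N - 2 - j))"
      unfolding Suc sum.lessThan_Suc_shift using s by (simp add: add.commute eval_nat_numeral)
    also have "\<dots> = (- 1) ^ m * (\<Sum>j<M. ?s (j + 1) * ?D (N - 2 - j))"
      unfolding star_sign_add3 by (simp add: sum_distrib_left mult.assoc)
    finally show ?thesis using Suc by simp
  qed simp
  have "(\<Sum>j<N + 2. ?s (j + 1) * ?D (N + 1 - j)) =
      ?s 1 * ?D (N + 1) + ?s 2 * ?D N + (\<Sum>j<N. ?s (j + 3) * ?D (N - 1 - j))"
    by (simp add: sum.lessThan_Suc_shift numeral_2_eq_2 numeral_3_eq_3 del: sum.lessThan_Suc)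
  then have sum: "(\<Sum>j<N + 2. ?s (j + 1) * ?D (N + 1 - j)) = (- 1) ^ m * ?D N - ?D (N + 1)
      + (- 1) ^ m * (\<Sum>j<N - 1. ?s (j + 1) * ?D (N - 2 - j))"
    unfolding tail s by simp
  have s45: "?s (N + 5) = (- 1) ^ m * ?s (N + 2)" "?s (N + 4) = (- 1) ^ m * ?s (N + 1)"
    using star_sign_add3[of m "N + 2"] star_sign_add3[of m "N + 1"] by (simp_all add: ac_simps)
  have D4: "?D (N + 4) = ?s (N + 5) - ?s (N + 4) - (\<Sum>j<N + 2. ?s (j + 1) * ?D (N + 1 - j))"
    using mtree_sign_comb_tree[of m "N + 4"] by (simp add: add.commute[of N] del: sum.lessThan_Suc)
  have D1: "?D (N + 1) = ?s (N + 2) - ?s (N + 1) - (\<Sum>j<N - 1. ?s (j + 1) * ?D (N - 2 - j))"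
    using mtree_sign_comb_tree[of m "N + 1"] by (simp add: numeral_2_eq_2 numeral_3_eq_3)
  \<comment> \<open>The star terms and the remaining sum combine to
    \<open>(- 1) ^ m * ?D (N + 1)\<close>.\<close>
  show ?thesis unfolding D4 sum s45 unfolding D1 by (simp add: algebra_simps)
qed

section \<open>From signed counts to the Euler characteristic\<close>

lemma sum_comb_critical_cells:
  "(\<Sum>I\<in>critical_cells (Delta m n) (comb_tree m n). (- 1) ^ card I) = mtree_sign (comb_tree m n)"
proof -
  have "nbrs (Delta m n) x \<subseteq> fst (Delta m n)" for x
  proof
    fix y assume "y \<in> nbrs (Delta m n) x"
    then show "y \<in> fst (Delta m n)"
      by (cases x; cases y) (auto simp: nbrs_Delta verts_Delta)
  qed
  moreover have "x \<notin> nbrs (Delta m n) x" for x by (cases x) (auto simp: nbrs_Delta)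
  ultimately show ?thesis
    using sum_critical_cells[of "Delta m n" "{}" "{}" "comb_tree m n"] comb_tree_is_matching_tree
    by (simp add: Ind_def)
qed

text \<open>A cell of dimension \<open>d\<close> has \<open>d + 1\<close> vertices, whence the minus
  sign. The case \<open>n = 0\<close> is separate because $X^m_0$ is prescribed as $S^0$ and not
  read off a tree.\<close>

lemma chi_eq_mtree_sign:
  assumes "m \<ge> 1"
  shows "chi m n = - mtree_sign (comb_tree m n)"
proof (cases "n = 0")
  case True
  have "mtree_sign (comb_tree m 0) = - 1"
    using mtree_sign_comb_tree[of m 0] star_sign_values[OF assms] by (simp add: star_sign_def[of m 0])
  moreover have "chi m 0 = (\<Sum>d\<in>{0}. (- 1) ^ d * C m 0 d)"
    unfolding chi_def by (rule Sum_any.expand_superset) (auto simp: C_def num_cells_def)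
  ultimately show ?thesis using True by (simp add: C_def num_cells_def)
next
  case False
  let ?K = "critical_cells (Delta m n) (comb_tree m n)"
  \<comment> \<open>The truncated subtraction agrees with \<open>face_dim\<close> because no
    critical cell is empty.\<close>
  let ?dim = "\<lambda>I :: vertex set. card I - 1"
  have fin: "finite ?K" by (rule finite_critical_cells)
  have ne: "I \<noteq> {}" if "I \<in> ?K" for I
    using that empty_notin_critical_cells[OF matches_empty_comb_tree[OF assms]] by metis
  have finI: "finite I" if "I \<in> ?K" for I
  proof -
    have "finite I" if "I \<in> critical_cells_at G A B T" "finite A" for G A B and T :: "vertex mtree"
      using that by (induction T arbitrary: A B) (auto split: if_splits)
    then show ?thesis using that by blast
  qed
  have card: "card I \<ge> 1" if "I \<in> ?K" for I
    using ne[OF that] finI[OF that] by (simp add: Suc_le_eq card_gt_0_iff)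
  \<comment> \<open>The base cell added in \<open>num_cells\<close> cancels against the one
    subtracted in \<open>C\<close>.\<close>
  have C: "C m n d = (\<Sum>I | I \<in> ?K \<and> ?dim I = d. 1)" for d
  proof -
    have "{I \<in> ?K. face_dim I = int d} = {I \<in> ?K. ?dim I = d}"
      using card by (force simp: face_dim_def)
    then show ?thesis using False by (simp add: C_def num_cells_def)
  qed
  have "chi m n = (\<Sum>d\<in>?dim ` ?K. (- 1) ^ d * C m n d)"
    unfolding chi_def
  proof (rule Sum_any.expand_superset)
    show "{d. (- 1) ^ d * C m n d \<noteq> 0} \<subseteq> ?dim ` ?K"
    proof
      fix d assume "d \<in> {d. (- 1) ^ d * C m n d \<noteq> 0}"
      then have "C m n d \<noteq> 0" by simp
      then have "{I. I \<in> ?K \<and> ?dim I = d} \<noteq> {}" unfolding C by (metis sum.empty)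
      then show "d \<in> ?dim ` ?K" by blast
    qed
  qed (use fin in simp)
  also have "\<dots> = (\<Sum>d\<in>?dim ` ?K. \<Sum>I | I \<in> ?K \<and> ?dim I = d. (- 1) ^ ?dim I)"
    unfolding C sum_distrib_left by (intro sum.cong) auto
  also have "\<dots> = (\<Sum>I\<in>?K. (- 1) ^ ?dim I)"
    using fin by (rule sum.image_gen[symmetric])
  also have "\<dots> = (\<Sum>I\<in>?K. - ((- 1) ^ card I))"
  proof (rule sum.cong[OF refl])
    fix I assume "I \<in> ?K"
    then obtain k where "card I = Suc k" using card[of I] by (cases "card I") auto
    then show "(- 1 :: int) ^ ?dim I = - ((- 1) ^ card I)" by simp
  qed
  finally show ?thesis by (simp add: sum_negf sum_comb_critical_cells)
qed

theorem corollary4p3: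
  fixes m :: nat
  assumes m_ge_2: "m \<ge> 2"
    and init_m_eq_2: "m = 2 \<Longrightarrow> \<forall>n\<in>{0..3}. \<forall>d.
      C m n d = (if n = 0 \<and> d = 0 then 1
                 else if n = 1 \<and> d = 1 then 2
                 else if n = 2 \<and> d = 2 then 1
                 else if n = 3 \<and> d = 2 then 2
                 else 0)"
    and init_m_ge_3: "m \<ge> 3 \<Longrightarrow> \<forall>n\<in>{0..3}. \<forall>d.
      C m n d = (if (n, d) \<in> {(0, 0), (1, 1), (1, m - 1), (2, m), (3, 2), (3, m)} then 1 else 0)"
  shows "\<forall>n\<ge>4. chi m n = (1 + (- 1) ^ m) * chi m (n - 3) + (- 1) ^ (m + 1) * chi m (n - 4)"
proof (intro allI impI)
  fix n :: nat
  assume "n \<ge> 4"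
  then obtain N where n: "n = N + 4" by (metis add.commute le_Suc_ex)
  have m: "m \<ge> 1" using m_ge_2 by simp
  have "n - 3 = N + 1" "n - 4 = N" using n by simp_all
  \<comment> \<open>The recurrence is linear and homogeneous, so it survives the change of
    sign.\<close>
  then show "chi m n = (1 + (- 1) ^ m) * chi m (n - 3) + (- 1) ^ (m + 1) * chi m (n - 4)"
    unfolding chi_eq_mtree_sign[OF m] using mtree_sign_comb_tree_rec[OF m, of N] n
    by (simp add: algebra_simps)
qed

end
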